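(* Let $N$ be a supernatural number, $n\in\mathbb Z$, and let $d:\mathcal A(N)\to A(N)$ be an $n$-covariant derivation in $A(N)$. If $N$ is infinite and $n\ne0$, or if $N$ is finite and $N\nmid n$, then $d$ is an inner derivation.
   Context: A supernatural number is a formal product $N=\prod_{p\text{ prime}}p^{\epsilon_p}$ with $\epsilon_p\in\{0,1,\dots,\infty\}$; it is finite (an ordinary positive integer) if $\sum_p\epsilon_p<\infty$, and infinite otherwise. A positive integer $j$ divides $N$ ($j\mid N$) if for each prime $p$ the exponent of $p$ in $j$ is at most $\epsilon_p$. On $\ell^2(\mathbb Z_{\ge0})$ with canonical basis $\{E_k\}_{k\ge 0}$ let $UE_k=E_{k+1}$ be the unilateral shift, $\mathbb KE_k=kE_k$, and for a sequence $a(k)$ let $a(\mathbb K)E_k=a(k)E_k$. Let $\mathcal A_{\mathrm{diag,per}}(N)=\{a(\mathbb K): a \text{ is } j\text{-periodic for some positive integer } j\mid N\}$. $A(N)$ is the C$^*$-algebra on $\ell^2(\mathbb Z_{\ge0})$ generated by $U$ and $\mathcal A_{\mathrm{diag,per}}(N)$; $\mathcal A(N)$ is the $^*$-subalgebra generated algebraically by $U,U^*,\mathcal A_{\mathrm{diag,per}}(N)$. A derivation in $A(N)$ is a linear map $d:\mathcal A(N)\to A(N)$ with $d(ab)=d(a)b+a\,d(b)$ (no continuity assumed). It is inner if there is $z\in A(N)$ with $d(a)=[z,a]$ for all $a\in\mathcal A(N)$. Let $\rho_\theta(a)=e^{i\theta\mathbb K}ae^{-i\theta\mathbb K}$, an automorphism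 of $A(N)$ preserving $\mathcal A(N)$. $d$ is $n$-covariant if $\rho_\theta^{-1}(d(\rho_\theta(a)))=e^{-in\theta}d(a)$ for all $\theta\in[0,2\pi)$, $a\in\mathcal A(N)$. *)

theory Defs
  imports "HOL-Analysis.Analysis" "HOL-Computational_Algebra.Primes" "HOL-Library.Extended_Nat"
begin

section \<open>Supernatural numbers\<close>

text \<open>
  A supernatural number is given by its prime exponents. Only the values at primes are ever
  used, so arbitrary functions on \<^typ>\<open>nat\<close> do no harm.
\<close>

type_synonym supernatural = "nat \<Rightarrow> enat"

text \<open>In \<^typ>\<open>enat\<close> every family is summable, so the sum below is never a junk value.\<close>

definition finite_supernatural :: "supernatural \<Rightarrow> bool" where
  "finite_supernatural N \<longleftrightarrow> infsum N {p. prime p} < \<infinity>"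

definition divides_supernatural :: "nat \<Rightarrow> supernatural \<Rightarrow> bool" where
  "divides_supernatural j N \<longleftrightarrow> 0 < j \<and> (\<forall>p. prime p \<longrightarrow> enat (multiplicity p j) \<le> N p)"

text \<open>The positive integer denoted by a finite supernatural number (junk if it is infinite).\<close>

definition nat_of_supernatural :: "supernatural \<Rightarrow> nat" where
  "nat_of_supernatural N = (\<Prod>p | prime p \<and> N p \<noteq> 0. p ^ the_enat (N p))"

lemma finite_supernatural_iff:
  "finite_supernatural N \<longleftrightarrow>
     finite {p. prime p \<and> N p \<noteq> 0} \<and> (\<forall>p. prime p \<longrightarrow> N p \<noteq> \<infinity>)"
proof -
  let ?P = "{p::nat. prime p}"
  let ?\<F> = "{F. finite F \<and> F \<subseteq> ?P}"
  have eq: "infsum N ?P = (SUP F\<in>?\<F>. sum N F)"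
    by (rule nonneg_infsum_complete) simp
  show ?thesis
  proof
    assume "finite_supernatural N"
    then obtain m where m: "infsum N ?P = enat m"
      unfolding finite_supernatural_def by (cases "infsum N ?P") auto
    have le: "sum N F \<le> enat m" if "finite F" "F \<subseteq> ?P" for F
      using that unfolding m[symmetric] eq by (intro SUP_upper) auto
    have "N p \<noteq> \<infinity>" if "prime p" for p
      using le[of "{p}"] that by (cases "N p") auto
    moreover have "finite {p. prime p \<and> N p \<noteq> 0}"
    proof (rule ccontr)
      assume "infinite {p. prime p \<and> N p \<noteq> 0}"
      then obtain F where F: "finite F" "card F = Suc m" "F \<subseteq> {p. prime p \<and> N p \<noteq> 0}"
        using infinite_arbitrarily_large by blast
      have "enat (Suc m) = (\<Sum>p\<in>F. (1::enat))"
        using F by (simp add: of_nat_eq_enat)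
      also have "\<dots> \<le> sum N F"
        using F by (intro sum_mono) (auto simp: one_enat_def Suc_ile_eq simp flip: zero_enat_def)
      also have "\<dots> \<le> enat m"
        using F by (intro le) auto
      finally show False by simp
    qed
    ultimately show "finite {p. prime p \<and> N p \<noteq> 0} \<and> (\<forall>p. prime p \<longrightarrow> N p \<noteq> \<infinity>)"
      by blast
  next
    assume *: "finite {p. prime p \<and> N p \<noteq> 0} \<and> (\<forall>p. prime p \<longrightarrow> N p \<noteq> \<infinity>)"
    have enat_the: "enat (the_enat (N p)) = N p" if "prime p" for p
      using * that by (cases "N p") auto
    have "infsum N ?P = infsum N {p. prime p \<and> N p \<noteq> 0}"
      by (rule infsum_cong_neutral) auto
    also have "\<dots> = sum N {p. prime p \<and> N p \<noteq> 0}"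
      using * by (intro infsum_finite) blast
    also have "\<dots> = (\<Sum>p\<in>{p. prime p \<and> N p \<noteq> 0}. enat (the_enat (N p)))"
      by (rule sum.cong[OF refl]) (use * in \<open>auto simp: enat_the\<close>)
    also have "\<dots> = enat (\<Sum>p\<in>{p. prime p \<and> N p \<noteq> 0}. the_enat (N p))"
      by (simp flip: of_nat_eq_enat)
    finally show "finite_supernatural N"
      unfolding finite_supernatural_def by simp
  qed
qed

lemma multiplicity_nat_of_supernatural:
  assumes "finite_supernatural N" "prime p"
  shows "enat (multiplicity p (nat_of_supernatural N)) = N p"
proof -
  have fin: "finite {p. prime p \<and> N p \<noteq> 0}" and ne: "N p \<noteq> \<infinity>"
    using assms by (auto simp: finite_supernatural_iff)
  have "multiplicity p (nat_of_supernatural N) =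
      (if p \<in> {p. prime p \<and> N p \<noteq> 0} then the_enat (N p) else 0)"
    unfolding nat_of_supernatural_def
    by (rule multiplicity_prod_prime_powers) (use fin assms(2) in auto)
  then show ?thesis
    using ne assms(2) by (cases "N p") (auto simp: zero_enat_def)
qed


section \<open>The Hilbert space of square-summable sequences\<close>

class complex_vector = real_vector +
  fixes scaleC :: "complex \<Rightarrow> 'a \<Rightarrow> 'a" (infixr "*\<^sub>C" 75)
  assumes scaleC_add_right: "a *\<^sub>C (x + y) = a *\<^sub>C x + a *\<^sub>C y"
    and scaleC_add_left: "(a + b) *\<^sub>C x = a *\<^sub>C x + b *\<^sub>C x"
    and scaleC_scaleC: "a *\<^sub>C b *\<^sub>C x = (a * b) *\<^sub>C x"
    and scaleC_one: "1 *\<^sub>C x = x"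
    and scaleR_scaleC: "r *\<^sub>R x = complex_of_real r *\<^sub>C x"

typedef ell2 = "{x :: nat \<Rightarrow> complex. summable (\<lambda>k. (cmod (x k))\<^sup>2)}"
  morphisms ell2_nth Abs_ell2
  by (rule exI[of _ "\<lambda>_. 0"]) simp

setup_lifting type_definition_ell2

lemma summable_ell2: "summable (\<lambda>k. (cmod (ell2_nth x k))\<^sup>2)"
  using ell2_nth[of x] by simp

lemma ell2_eqI: "(\<And>k. ell2_nth x k = ell2_nth y k) \<Longrightarrow> x = y"
  by (metis ell2_nth_inject ext)

lemma cmod_add_sq_le: "(cmod (a + b))\<^sup>2 \<le> 2 * (cmod a)\<^sup>2 + 2 * (cmod b)\<^sup>2"
proof -
  have "(cmod (a + b))\<^sup>2 \<le> (cmod a + cmod b)\<^sup>2"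
    by (intro power_mono norm_triangle_ineq) auto
  also have "\<dots> \<le> 2 * (cmod a)\<^sup>2 + 2 * (cmod b)\<^sup>2"
    using sum_squares_bound[of "cmod a" "cmod b"] by (simp add: power2_sum)
  finally show ?thesis .
qed

instantiation ell2 :: complex_vector
begin

lift_definition zero_ell2 :: ell2 is "\<lambda>_. 0" by simp

lift_definition plus_ell2 :: "ell2 \<Rightarrow> ell2 \<Rightarrow> ell2" is "\<lambda>x y k. x k + y k"
proof -
  fix x y :: "nat \<Rightarrow> complex"
  assume "summable (\<lambda>k. (cmod (x k))\<^sup>2)" "summable (\<lambda>k. (cmod (y k))\<^sup>2)"
  then have "summable (\<lambda>k. 2 * (cmod (x k))\<^sup>2 + 2 * (cmod (y k))\<^sup>2)"
    by (intro summable_add summable_mult)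
  then show "summable (\<lambda>k. (cmod (x k + y k))\<^sup>2)"
    by (rule summable_comparison_test') (use cmod_add_sq_le in simp)
qed

lift_definition scaleC_ell2 :: "complex \<Rightarrow> ell2 \<Rightarrow> ell2" is "\<lambda>c x k. c * x k"
  by (simp add: norm_mult power_mult_distrib summable_mult)

definition scaleR_ell2 :: "real \<Rightarrow> ell2 \<Rightarrow> ell2" where
  "r *\<^sub>R x = complex_of_real r *\<^sub>C (x :: ell2)"

definition uminus_ell2 :: "ell2 \<Rightarrow> ell2" where "- x = (-1) *\<^sub>C (x :: ell2)"

definition minus_ell2 :: "ell2 \<Rightarrow> ell2 \<Rightarrow> ell2" where "x - y = x + - (y :: ell2)"

instance
proof
  fix x y z :: ell2 and c c' :: complex and r r' :: real
  have eq: "x = y" if "ell2_nth x = ell2_nth y" for x y using that by (simp add: ell2_nth_inject)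
  note rep = zero_ell2.rep_eq plus_ell2.rep_eq scaleC_ell2.rep_eq scaleR_ell2_def
    uminus_ell2_def minus_ell2_def
  show "x + y + z = x + (y + z)" "x + y = y + x" "0 + x = x" "- x + x = 0" "x - y = x + - y"
    by (rule eq; simp add: rep algebra_simps)+
  show "r *\<^sub>R (x + y) = r *\<^sub>R x + r *\<^sub>R y" "(r + r') *\<^sub>R x = r *\<^sub>R x + r' *\<^sub>R x"
    "r *\<^sub>R r' *\<^sub>R x = (r * r') *\<^sub>R x" "1 *\<^sub>R x = x"
    by (rule eq; simp add: rep algebra_simps)+
  show "c *\<^sub>C (x + y) = c *\<^sub>C x + c *\<^sub>C y" "(c + c') *\<^sub>C x = c *\<^sub>C x + c' *\<^sub>C x"
    "c *\<^sub>C c' *\<^sub>C x = (c * c') *\<^sub>C x" "1 *\<^sub>C x = x"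
    by (rule eq; simp add: rep algebra_simps)+
  show "r *\<^sub>R x = complex_of_real r *\<^sub>C x" by (rule scaleR_ell2_def)
qed

end

lemma ell2_nth_simps [simp]:
  "ell2_nth 0 k = 0"
  "ell2_nth (x + y) k = ell2_nth x k + ell2_nth y k"
  "ell2_nth (c *\<^sub>C x) k = c * ell2_nth x k"
  "ell2_nth (r *\<^sub>R x) k = complex_of_real r * ell2_nth x k"
  "ell2_nth (- x) k = - ell2_nth x k"
  "ell2_nth (x - y) k = ell2_nth x k - ell2_nth y k"
  by (simp_all add: zero_ell2.rep_eq plus_ell2.rep_eq scaleC_ell2.rep_eq scaleR_ell2_def
      uminus_ell2_def minus_ell2_def)

text \<open>The complex inner product, linear in its first argument.\<close>

definition cinner :: "ell2 \<Rightarrow> ell2 \<Rightarrow> complex" where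
  "cinner x y = (\<Sum>k. ell2_nth x k * cnj (ell2_nth y k))"

lemma summable_cinner: "summable (\<lambda>k. ell2_nth x k * cnj (ell2_nth y k))"
proof (rule summable_comparison_test')
  show "summable (\<lambda>k. (cmod (ell2_nth x k))\<^sup>2 + (cmod (ell2_nth y k))\<^sup>2)"
    by (intro summable_add summable_ell2)
  fix k
  have "0 \<le> cmod (ell2_nth x k) * cmod (ell2_nth y k)" by simp
  then show "norm (ell2_nth x k * cnj (ell2_nth y k))
      \<le> (cmod (ell2_nth x k))\<^sup>2 + (cmod (ell2_nth y k))\<^sup>2"
    using sum_squares_bound[of "cmod (ell2_nth x k)" "cmod (ell2_nth y k)"]
    unfolding norm_mult complex_mod_cnj by linarith
qed

lemma cinner_sums: "(\<lambda>k. ell2_nth x k * cnj (ell2_nth y k)) sums cinner x y"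
  unfolding cinner_def by (rule summable_sums[OF summable_cinner])

lemma cinner_add_left: "cinner (x + y) z = cinner x z + cinner y z"
  using sums_unique2[OF cinner_sums[of "x + y" z] , of "cinner x z + cinner y z"]
    sums_add[OF cinner_sums[of x z] cinner_sums[of y z]]
  by (simp add: algebra_simps)

lemma cinner_scaleC_left: "cinner (c *\<^sub>C x) y = c * cinner x y"
  using sums_unique2[OF cinner_sums[of "c *\<^sub>C x" y] , of "c * cinner x y"]
    sums_mult[OF cinner_sums[of x y], of c]
  by (simp add: algebra_simps)

lemma cinner_commute: "cinner x y = cnj (cinner y x)"
proof -
  have "(\<lambda>k. cnj (ell2_nth y k * cnj (ell2_nth x k))) sums cnj (cinner y x)"
    by (subst sums_cnj) (rule cinner_sums)
  then show ?thesis
    using sums_unique2[OF cinner_sums[of x y]] by (simp add: mult.commute)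
qed

lemma cinner_self: "cinner x x = complex_of_real (\<Sum>k. (cmod (ell2_nth x k))\<^sup>2)"
proof -
  have "(\<lambda>k. complex_of_real ((cmod (ell2_nth x k))\<^sup>2))
      sums complex_of_real (\<Sum>k. (cmod (ell2_nth x k))\<^sup>2)"
    by (intro sums_of_real summable_sums summable_ell2)
  moreover have "complex_of_real ((cmod (ell2_nth x k))\<^sup>2) = ell2_nth x k * cnj (ell2_nth x k)" for k
    using complex_norm_square[of "ell2_nth x k"] by simp
  ultimately show ?thesis
    using sums_unique2[OF cinner_sums[of x x]] by simp
qed

instantiation ell2 :: real_inner
begin

definition inner_ell2 :: "ell2 \<Rightarrow> ell2 \<Rightarrow> real" where "inner x y = Re (cinner x y)"

definition norm_ell2 :: "ell2 \<Rightarrow> real" where "norm x = sqrt (\<Sum>k. (cmod (ell2_nth x k))\<^sup>2)"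

definition dist_ell2 :: "ell2 \<Rightarrow> ell2 \<Rightarrow> real" where "dist x y = norm (x - y :: ell2)"

definition sgn_ell2 :: "ell2 \<Rightarrow> ell2" where "sgn x = inverse (norm x) *\<^sub>R (x :: ell2)"

definition uniformity_ell2 :: "(ell2 \<times> ell2) filter" where
  "uniformity = (INF e\<in>{0 <..}. principal {(x, y :: ell2). dist x y < e})"

definition open_ell2 :: "ell2 set \<Rightarrow> bool" where
  "open S = (\<forall>x\<in>S. \<forall>\<^sub>F (x', y :: ell2) in uniformity. x' = x \<longrightarrow> y \<in> S)"

instance
proof
  fix x y z :: ell2 and r :: real
  show "inner x y = inner y x"
    unfolding inner_ell2_def by (subst cinner_commute) simp
  show "inner (x + y) z = inner x z + inner y z"
    by (simp add: inner_ell2_def cinner_add_left)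
  show "inner (r *\<^sub>R x) y = r * inner x y"
    by (simp add: inner_ell2_def scaleR_ell2_def cinner_scaleC_left)
  show "0 \<le> inner x x"
    by (simp add: inner_ell2_def cinner_self suminf_nonneg summable_ell2)
  show "inner x x = 0 \<longleftrightarrow> x = 0"
    by (auto simp: inner_ell2_def cinner_self suminf_eq_zero_iff summable_ell2 intro: ell2_eqI)
  show "norm x = sqrt (inner x x)"
    by (simp add: norm_ell2_def inner_ell2_def cinner_self)
qed (rule dist_ell2_def sgn_ell2_def uniformity_ell2_def open_ell2_def)+

end

lemma norm_ell2_sq: "(norm x)\<^sup>2 = (\<Sum>k. (cmod (ell2_nth x k))\<^sup>2)"
  by (simp add: norm_ell2_def suminf_nonneg summable_ell2)

lemma norm_scaleC_ell2: "norm (c *\<^sub>C x) = cmod c * norm (x :: ell2)"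
  by (simp add: norm_ell2_def norm_mult power_mult_distrib suminf_mult summable_ell2
      real_sqrt_mult)

lemma norm_cinner_le: "cmod (cinner x y) \<le> norm x * norm y"
proof (cases "cinner x y = 0")
  case False
  define u where "u = cnj (cinner x y) / complex_of_real (cmod (cinner x y))"
  have u: "cmod u = 1" using False by (simp add: u_def norm_divide)
  have "cnj (cinner x y) * cinner x y = complex_of_real ((cmod (cinner x y))\<^sup>2)"
    by (simp only: complex_norm_square mult.commute)
  then have "u * cinner x y = complex_of_real (cmod (cinner x y))"
    using False by (simp add: u_def power2_eq_square)
  then have "cmod (cinner x y) = inner (u *\<^sub>C x) y"
    by (simp add: inner_ell2_def cinner_scaleC_left)
  also have "\<dots> \<le> norm (u *\<^sub>C x) * norm y" by (rule norm_cauchy_schwarz)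
  finally show ?thesis by (simp add: norm_scaleC_ell2 u)
qed simp

lift_definition E :: "nat \<Rightarrow> ell2" is "\<lambda>k i. if i = k then 1 else 0"
proof -
  fix k :: nat
  show "summable (\<lambda>i. (cmod (if i = k then 1 else 0))\<^sup>2)"
    by (rule summable_finite[of "{k}"]) auto
qed

lemma ell2_nth_E [simp]: "ell2_nth (E k) i = (if i = k then 1 else 0)"
  by (simp add: E.rep_eq)

lemma cinner_E_right: "cinner x (E k) = ell2_nth x k"
proof -
  have "(\<lambda>i. ell2_nth x i * cnj (ell2_nth (E k) i)) sums
      (\<Sum>i\<in>{k}. ell2_nth x i * cnj (ell2_nth (E k) i))"
    by (rule sums_finite) auto
  then show ?thesis using sums_unique2[OF cinner_sums[of x "E k"]] by simp
qed

lemma norm_E [simp]: "norm (E k) = 1"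
  by (simp add: norm_eq_sqrt_inner inner_ell2_def cinner_E_right)


section \<open>Bounded linear operators\<close>

typedef bop = "{T :: ell2 \<Rightarrow> ell2. bounded_linear T \<and> (\<forall>c x. T (c *\<^sub>C x) = c *\<^sub>C T x)}"
  morphisms bop_apply Abs_bop
  by (rule exI[of _ "\<lambda>_. 0"]) (auto intro: ell2_eqI)

setup_lifting type_definition_bop

lemma bounded_linear_bop: "bounded_linear (bop_apply T)"
  using bop_apply[of T] by simp

lemma bop_apply_scaleC: "bop_apply T (c *\<^sub>C x) = c *\<^sub>C bop_apply T x"
  using bop_apply[of T] by simp

lemma bop_eqI: "(\<And>x. bop_apply S x = bop_apply T x) \<Longrightarrow> S = T"
  by (metis bop_apply_inject ext)

lemma bounded_linear_scaleC_ell2: "bounded_linear (\<lambda>x::ell2. c *\<^sub>C x)"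
proof (rule bounded_linear_intro[where K = "cmod c"])
  fix x y :: ell2 and r :: real
  show "c *\<^sub>C (x + y) = c *\<^sub>C x + c *\<^sub>C y" by (rule scaleC_add_right)
  show "c *\<^sub>C r *\<^sub>R x = r *\<^sub>R c *\<^sub>C x" by (rule ell2_eqI) simp
  show "norm (c *\<^sub>C x) \<le> norm x * cmod c" by (simp add: norm_scaleC_ell2)
qed

text \<open>Multiplication of operators is composition, and the norm is the operator norm.\<close>

instantiation bop :: "{complex_vector, real_normed_algebra_1}"
begin

lift_definition zero_bop :: bop is "\<lambda>_. 0" by (auto intro: ell2_eqI)

lift_definition one_bop :: bop is "\<lambda>x. x" by (auto intro: bounded_linear_ident)

lift_definition plus_bop :: "bop \<Rightarrow> bop \<Rightarrow> bop" is "\<lambda>S T x. S x + T x"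
  by (auto intro: bounded_linear_add simp: scaleC_add_right)

lift_definition uminus_bop :: "bop \<Rightarrow> bop" is "\<lambda>T x. - T x"
  by (auto intro: bounded_linear_minus ell2_eqI)

lift_definition minus_bop :: "bop \<Rightarrow> bop \<Rightarrow> bop" is "\<lambda>S T x. S x - T x"
  by (auto intro: bounded_linear_sub ell2_eqI simp: algebra_simps)

lift_definition times_bop :: "bop \<Rightarrow> bop \<Rightarrow> bop" is "\<lambda>S T x. S (T x)"
  by (auto intro: bounded_linear_compose)

lift_definition scaleC_bop :: "complex \<Rightarrow> bop \<Rightarrow> bop" is "\<lambda>c T x. c *\<^sub>C T x"
  by (auto intro: bounded_linear_compose[OF bounded_linear_scaleC_ell2]
      simp: scaleC_scaleC mult.commute)

definition scaleR_bop :: "real \<Rightarrow> bop \<Rightarrow> bop" where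
  "r *\<^sub>R T = complex_of_real r *\<^sub>C (T :: bop)"

definition norm_bop :: "bop \<Rightarrow> real" where "norm T = onorm (bop_apply T)"

definition dist_bop :: "bop \<Rightarrow> bop \<Rightarrow> real" where "dist S T = norm (S - T :: bop)"

definition sgn_bop :: "bop \<Rightarrow> bop" where "sgn T = inverse (norm T) *\<^sub>R (T :: bop)"

definition uniformity_bop :: "(bop \<times> bop) filter" where
  "uniformity = (INF e\<in>{0 <..}. principal {(S, T :: bop). dist S T < e})"

definition open_bop :: "bop set \<Rightarrow> bool" where
  "open W = (\<forall>S\<in>W. \<forall>\<^sub>F (S', T :: bop) in uniformity. S' = S \<longrightarrow> T \<in> W)"

instance
proof
  note rep = zero_bop.rep_eq one_bop.rep_eq plus_bop.rep_eq uminus_bop.rep_eq minus_bop.rep_eq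
    times_bop.rep_eq scaleC_bop.rep_eq
  have add: "bop_apply T (x + y) = bop_apply T x + bop_apply T y" for T x y
    by (rule linear_add[OF bounded_linear.linear[OF bounded_linear_bop]])
  fix S T V :: bop and c c' :: complex and r r' :: real
  show "S + T + V = S + (T + V)" "S + T = T + S" "0 + S = S" "- S + S = 0" "S - T = S + - T"
    by (rule bop_eqI; simp add: rep ac_simps)+
  show "c *\<^sub>C (S + T) = c *\<^sub>C S + c *\<^sub>C T" "(c + c') *\<^sub>C S = c *\<^sub>C S + c' *\<^sub>C S"
    "c *\<^sub>C c' *\<^sub>C S = (c * c') *\<^sub>C S" "1 *\<^sub>C S = S"
    by (rule bop_eqI; simp add: rep scaleC_add_right scaleC_add_left scaleC_scaleC scaleC_one)+
  show "r *\<^sub>R S = complex_of_real r *\<^sub>C S" by (rule scaleR_bop_def)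
  have rR: "bop_apply (r *\<^sub>R S) x = r *\<^sub>R bop_apply S x" for r S x
    by (simp add: scaleR_bop_def scaleR_ell2_def rep)
  show "r *\<^sub>R (S + T) = r *\<^sub>R S + r *\<^sub>R T" "(r + r') *\<^sub>R S = r *\<^sub>R S + r' *\<^sub>R S"
    "r *\<^sub>R r' *\<^sub>R S = (r * r') *\<^sub>R S" "1 *\<^sub>R S = S"
    by (rule bop_eqI; simp add: rep rR algebra_simps)+
  show "S * T * V = S * (T * V)" "1 * S = S" "S * 1 = S" "(S + T) * V = S * V + T * V"
    "S * (T + V) = S * T + S * V"
    by (rule bop_eqI; simp add: rep add)+
  show "r *\<^sub>R S * T = r *\<^sub>R (S * T)" "S * r *\<^sub>R T = r *\<^sub>R (S * T)"
    by (rule bop_eqI; simp add: rep rR linear_scale[OF bounded_linear.linear[OF bounded_linear_bop]])+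
  show "(0::bop) \<noteq> 1"
  proof
    assume "(0::bop) = 1"
    then have "bop_apply 0 (E 0) = bop_apply 1 (E 0)" by simp
    then have "norm (E 0) = 0" by (simp add: rep)
    then show False by simp
  qed
  show "norm S = 0 \<longleftrightarrow> S = 0"
    by (auto simp: norm_bop_def onorm_eq_0[OF bounded_linear_bop] rep intro: bop_eqI)
  show "norm (S + T) \<le> norm S + norm T"
    unfolding norm_bop_def rep by (rule onorm_triangle[OF bounded_linear_bop bounded_linear_bop])
  show "norm (r *\<^sub>R S) = \<bar>r\<bar> * norm S"
    unfolding norm_bop_def using onorm_scaleR[OF bounded_linear_bop, of r S]
    by (simp add: rR[abs_def] del: scaleR_conv_of_real)
  show "norm (S * T) \<le> norm S * norm T"
    unfolding norm_bop_def rep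
    using onorm_compose[OF bounded_linear_bop bounded_linear_bop, of S T] by (simp add: o_def)
  show "norm (1::bop) = 1"
  proof (rule antisym)
    show "norm (1::bop) \<le> 1" unfolding norm_bop_def rep by (rule onorm_id_le)
    show "1 \<le> norm (1::bop)"
      unfolding norm_bop_def rep using le_onorm[OF bounded_linear_ident, of "E 0"] by simp
  qed
qed (rule dist_bop_def sgn_bop_def uniformity_bop_def open_bop_def)+

end

lemma bop_apply_simps [simp]:
  "bop_apply 0 x = 0"
  "bop_apply 1 x = x"
  "bop_apply (S + T) x = bop_apply S x + bop_apply T x"
  "bop_apply (- T) x = - bop_apply T x"
  "bop_apply (S - T) x = bop_apply S x - bop_apply T x"
  "bop_apply (S * T) x = bop_apply S (bop_apply T x)"
  "bop_apply (c *\<^sub>C T) x = c *\<^sub>C bop_apply T x"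
  by (simp_all add: zero_bop.rep_eq one_bop.rep_eq plus_bop.rep_eq uminus_bop.rep_eq
      minus_bop.rep_eq times_bop.rep_eq scaleC_bop.rep_eq)

lemma ell2_partial_sums: "(\<lambda>n. \<Sum>k<n. ell2_nth x k *\<^sub>C E k) \<longlonglongrightarrow> x"
proof -
  let ?v = "\<lambda>n. \<Sum>k<n. ell2_nth x k *\<^sub>C E k"
  have nth: "ell2_nth (?v n) i = (if i < n then ell2_nth x i else 0)" for n i
    by (induction n) (auto, metis not_less_less_Suc_eq)
  have "(norm (x - ?v n))\<^sup>2 = (\<Sum>k. (cmod (ell2_nth x k))\<^sup>2) - (\<Sum>k<n. (cmod (ell2_nth x k))\<^sup>2)" for n
  proof -
    let ?g = "\<lambda>k. if k \<in> {..<n} then (cmod (ell2_nth x k))\<^sup>2 else 0"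
    have "(\<lambda>k. (cmod (ell2_nth x k))\<^sup>2 - ?g k) sums
       ((\<Sum>k. (cmod (ell2_nth x k))\<^sup>2) - (\<Sum>k<n. (cmod (ell2_nth x k))\<^sup>2))"
      by (intro sums_diff summable_sums summable_ell2 sums_If_finite_set) simp
    moreover have "(\<lambda>k. (cmod (ell2_nth x k))\<^sup>2 - ?g k) = (\<lambda>k. (cmod (ell2_nth (x - ?v n) k))\<^sup>2)"
      by (auto simp: nth)
    ultimately show ?thesis by (simp add: norm_ell2_sq sums_iff)
  qed
  moreover have "(\<lambda>n. (\<Sum>k. (cmod (ell2_nth x k))\<^sup>2) - (\<Sum>k<n. (cmod (ell2_nth x k))\<^sup>2))
      \<longlonglongrightarrow> (\<Sum>k. (cmod (ell2_nth x k))\<^sup>2) - (\<Sum>k. (cmod (ell2_nth x k))\<^sup>2)"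
    by (intro tendsto_diff tendsto_const summable_LIMSEQ summable_ell2)
  ultimately have "(\<lambda>n. (norm (x - ?v n))\<^sup>2) \<longlonglongrightarrow> 0" by simp
  then have "(\<lambda>n. sqrt ((norm (x - ?v n))\<^sup>2)) \<longlonglongrightarrow> sqrt 0" by (rule tendsto_real_sqrt)
  then have "(\<lambda>n. norm (?v n - x)) \<longlonglongrightarrow> 0" by (simp add: norm_minus_commute)
  then show ?thesis by (rule LIM_zero_cancel[OF tendsto_norm_zero_cancel])
qed

lemma cinner_zero_left [simp]: "cinner 0 y = 0"
  by (simp add: cinner_def)

lemma cinner_sum_left: "cinner (\<Sum>k\<in>K. f k) y = (\<Sum>k\<in>K. cinner (f k) y)"
  by (induction K rule: infinite_finite_induct) (simp_all add: cinner_add_left)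

lemma bounded_linear_cinner_left: "bounded_linear (\<lambda>x. cinner x y)"
  by (rule bounded_linear_intro[where K = "norm y"])
    (simp_all add: cinner_add_left scaleR_ell2_def cinner_scaleC_left norm_cinner_le
      scaleR_conv_of_real)

lemma ell2_eqI_cinner: "(\<And>x. cinner x y = cinner x z) \<Longrightarrow> y = z"
  by (rule ell2_eqI) (metis cinner_E_right cinner_commute)

lemma adjoint_exists: "\<exists>S. \<forall>x y. cinner (bop_apply T x) y = cinner x (bop_apply S y)"
proof -
  define c where "c = (\<lambda>y k. cinner y (bop_apply T (E k)))"
  interpret T: bounded_linear "bop_apply T" by (rule bounded_linear_bop)
  have part: "cinner (bop_apply T (\<Sum>k<n. a k *\<^sub>C E k)) y = (\<Sum>k<n. a k * cnj (c y k))" for a n y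
    unfolding c_def T.sum cinner_sum_left bop_apply_scaleC cinner_scaleC_left
    by (subst cinner_commute) simp
  have bound: "(\<Sum>k<n. (cmod (c y k))\<^sup>2) \<le> (norm T * norm y)\<^sup>2" for y n
  proof -
    let ?v = "\<Sum>k<n. c y k *\<^sub>C E k" and ?s = "\<Sum>k<n. (cmod (c y k))\<^sup>2"
    have nth: "ell2_nth ?v i = (if i < n then c y i else 0)" for i
      by (induction n) (auto, metis not_less_less_Suc_eq)
    have "(\<lambda>k. if k \<in> {..<n} then (cmod (c y k))\<^sup>2 else 0) sums ?s"
      by (rule sums_If_finite_set) simp
    moreover have "(\<lambda>k. if k \<in> {..<n} then (cmod (c y k))\<^sup>2 else 0) = (\<lambda>k. (cmod (ell2_nth ?v k))\<^sup>2)"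
      by (auto simp: nth)
    ultimately have nv: "(norm ?v)\<^sup>2 = ?s"
      by (simp add: norm_ell2_sq sums_iff)
    have "complex_of_real ?s = cinner (bop_apply T ?v) y"
      unfolding part of_real_sum complex_norm_square ..
    then have "?s = cmod (cinner (bop_apply T ?v) y)"
      by (metis (no_types, lifting) abs_of_nonneg norm_of_real sum_nonneg zero_le_power2)
    also have "\<dots> \<le> norm (bop_apply T ?v) * norm y" by (rule norm_cinner_le)
    also have "\<dots> \<le> norm T * norm ?v * norm y"
      unfolding norm_bop_def by (intro mult_right_mono onorm bounded_linear_bop) simp
    finally have "norm ?v * norm ?v \<le> (norm T * norm y) * norm ?v"
      unfolding nv[symmetric] by (simp only: power2_eq_square ac_simps)
    then have "norm ?v \<le> norm T * norm y"
      by (cases "norm ?v = 0") (simp, simp only: mult_le_cancel_right, auto)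
    then have "(norm ?v)\<^sup>2 \<le> (norm T * norm y)\<^sup>2" by (intro power_mono) auto
    then show ?thesis by (simp add: nv)
  qed
  have summ: "summable (\<lambda>k. (cmod (c y k))\<^sup>2)" for y
    by (rule summableI_nonneg_bounded[OF _ bound]) simp
  define S where "S = (\<lambda>y. Abs_ell2 (c y))"
  have S_nth: "ell2_nth (S y) = c y" for y
    unfolding S_def using summ by (simp add: Abs_ell2_inverse)
  have c_add: "c (y + z) k = c y k + c z k" and c_scale: "c (a *\<^sub>C y) k = a * c y k" for y z a k
    by (simp_all add: c_def cinner_add_left cinner_scaleC_left)
  have S_scale: "S (a *\<^sub>C y) = a *\<^sub>C S y" for a y
    by (rule ell2_eqI) (simp add: S_nth c_scale)
  have "bounded_linear S"
  proof (rule bounded_linear_intro[where K = "norm T"])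
    fix y z :: ell2 and r :: real
    show "S (y + z) = S y + S z" by (rule ell2_eqI) (simp add: S_nth c_add)
    show "S (r *\<^sub>R y) = r *\<^sub>R S y" by (simp add: scaleR_ell2_def S_scale)
    have "(norm (S y))\<^sup>2 \<le> (norm T * norm y)\<^sup>2"
      unfolding norm_ell2_sq S_nth by (rule suminf_le_const[OF summ bound])
    then show "norm (S y) \<le> norm y * norm T"
      by (subst mult.commute) (rule power2_le_imp_le, simp_all)
  qed
  then have S_bop: "bop_apply (Abs_bop S) = S"
    using S_scale by (simp add: Abs_bop_inverse)
  have "cinner (bop_apply T x) y = cinner x (S y)" for x y
  proof -
    have "(\<lambda>n. cinner (bop_apply T (\<Sum>k<n. ell2_nth x k *\<^sub>C E k)) y) \<longlonglongrightarrow> cinner (bop_apply T x) y"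
      by (intro bounded_linear.tendsto[OF bounded_linear_cinner_left]
          bounded_linear.tendsto[OF bounded_linear_bop] ell2_partial_sums)
    moreover have "(\<lambda>n. \<Sum>k<n. ell2_nth x k * cnj (c y k)) \<longlonglongrightarrow> cinner x (S y)"
      using cinner_sums[of x "S y"] by (simp add: sums_def S_nth)
    ultimately show ?thesis
      unfolding part by (rule LIMSEQ_unique)
  qed
  then show ?thesis using S_bop by metis
qed

definition adj :: "bop \<Rightarrow> bop" where
  "adj T = (THE S. \<forall>x y. cinner (bop_apply T x) y = cinner x (bop_apply S y))"

lemma cinner_adj: "cinner (bop_apply T x) y = cinner x (bop_apply (adj T) y)"
proof -
  have "\<exists>!S. \<forall>x y. cinner (bop_apply T x) y = cinner x (bop_apply S y)"
    using adjoint_exists[of T] by (metis bop_eqI ell2_eqI_cinner)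
  from theI'[OF this] show ?thesis unfolding adj_def by blast
qed


section \<open>The algebras\<close>

lift_definition shift_ell2 :: "ell2 \<Rightarrow> ell2" is
  "\<lambda>x k. case k of 0 \<Rightarrow> 0 | Suc i \<Rightarrow> x i"
  by (subst summable_Suc_iff[symmetric]) simp

lemma norm_shift_ell2: "norm (shift_ell2 x) = norm x"
proof -
  have "summable (\<lambda>k. (cmod (ell2_nth (shift_ell2 x) k))\<^sup>2)" by (rule summable_ell2)
  from suminf_split_head[OF this] show ?thesis by (simp add: norm_ell2_def shift_ell2.rep_eq)
qed

lift_definition U :: bop is shift_ell2
proof (intro conjI allI)
  show scaleC: "shift_ell2 (c *\<^sub>C x) = c *\<^sub>C shift_ell2 x" for c x
    by (rule ell2_eqI) (simp add: shift_ell2.rep_eq split: nat.split)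
  show "bounded_linear shift_ell2"
  proof (rule bounded_linear_intro[where K = 1])
    show "shift_ell2 (x + y) = shift_ell2 x + shift_ell2 y" for x y
      by (rule ell2_eqI) (simp add: shift_ell2.rep_eq split: nat.split)
  qed (simp_all add: scaleR_ell2_def scaleC norm_shift_ell2)
qed

lemma U_E: "bop_apply U (E k) = E (Suc k)"
  by (rule ell2_eqI) (auto simp: U.rep_eq shift_ell2.rep_eq split: nat.split)

text \<open>
  \<open>diag a\<close> is the operator \<open>a(\<K>)\<close>. It is only meaningful for bounded sequences \<open>a\<close> (such as
  periodic or unimodular ones); for unbounded \<open>a\<close> it is the zero operator.
\<close>

lift_definition diag_ell2 :: "(nat \<Rightarrow> complex) \<Rightarrow> ell2 \<Rightarrow> ell2" is
  "\<lambda>a x k. if bounded (range a) then a k * x k else 0"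
proof -
  fix a x :: "nat \<Rightarrow> complex"
  assume x: "summable (\<lambda>k. (cmod (x k))\<^sup>2)"
  show "summable (\<lambda>k. (cmod (if bounded (range a) then a k * x k else 0))\<^sup>2)"
  proof (cases "bounded (range a)")
    case True
    then obtain B where B: "\<And>k. cmod (a k) \<le> B" by (auto simp: bounded_iff)
    have "summable (\<lambda>k. B\<^sup>2 * (cmod (x k))\<^sup>2)" using x by (rule summable_mult)
    then show ?thesis
      by (rule summable_comparison_test')
        (auto simp: norm_mult power_mult_distrib intro!: mult_right_mono power_mono B)
  qed simp
qed

lift_definition diag :: "(nat \<Rightarrow> complex) \<Rightarrow> bop" is diag_ell2
proof (intro conjI allI)
  fix a :: "nat \<Rightarrow> complex"
  show scaleC: "diag_ell2 a (c *\<^sub>C x) = c *\<^sub>C diag_ell2 a x" for c x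
    by (rule ell2_eqI) (simp add: diag_ell2.rep_eq)
  have "\<exists>B. \<forall>k. bounded (range a) \<longrightarrow> cmod (a k) \<le> B"
    unfolding bounded_iff by (metis rangeI)
  then obtain B where B: "bounded (range a) \<Longrightarrow> cmod (a k) \<le> B" for k by blast
  show "bounded_linear (diag_ell2 a)"
  proof (rule bounded_linear_intro[where K = "\<bar>B\<bar>"])
    show "diag_ell2 a (x + y) = diag_ell2 a x + diag_ell2 a y" for x y
      by (rule ell2_eqI) (simp add: diag_ell2.rep_eq algebra_simps)
    show "diag_ell2 a (r *\<^sub>R x) = r *\<^sub>R diag_ell2 a x" for r x
      by (simp add: scaleR_ell2_def scaleC)
    fix x
    have "(cmod (ell2_nth (diag_ell2 a x) k))\<^sup>2 \<le> \<bar>B\<bar>\<^sup>2 * (cmod (ell2_nth x k))\<^sup>2" for k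
    proof (cases "bounded (range a)")
      case True
      then have "cmod (a k) \<le> \<bar>B\<bar>" using B[of k] by linarith
      then have "(cmod (a k))\<^sup>2 \<le> \<bar>B\<bar>\<^sup>2" by (intro power_mono) auto
      then show ?thesis
        using True by (simp add: diag_ell2.rep_eq norm_mult power_mult_distrib mult_right_mono)
    qed (simp add: diag_ell2.rep_eq)
    then have "(norm (diag_ell2 a x))\<^sup>2 \<le> (\<Sum>k. \<bar>B\<bar>\<^sup>2 * (cmod (ell2_nth x k))\<^sup>2)"
      unfolding norm_ell2_sq by (intro suminf_le summable_ell2 summable_mult)
    also have "\<dots> = (norm x * \<bar>B\<bar>)\<^sup>2"
      by (simp add: suminf_mult summable_ell2 norm_ell2_sq power_mult_distrib)
    finally show "norm (diag_ell2 a x) \<le> norm x * \<bar>B\<bar>"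
      by (rule power2_le_imp_le) simp
  qed
qed

lemma diag_E:
  assumes "bounded (range a)"
  shows "bop_apply (diag a) (E k) = a k *\<^sub>C E k"
  using assms by (intro ell2_eqI) (auto simp: diag.rep_eq diag_ell2.rep_eq)

definition periodic :: "nat \<Rightarrow> (nat \<Rightarrow> complex) \<Rightarrow> bool" where
  "periodic j a \<longleftrightarrow> (\<forall>k. a (k + j) = a k)"

lemma periodic_bounded:
  assumes "periodic j a" "0 < j"
  shows "bounded (range a)"
proof -
  have "a (k + m * j) = a k" for k m
  proof (induction m)
    case (Suc m)
    then show ?case
      using assms(1)[unfolded periodic_def, rule_format, of "k + m * j"] by (simp add: ac_simps)
  qed simp
  then have "a k = a (k mod j)" for k
    by (metis mod_mult_div_eq mult.commute)
  then have "range a \<subseteq> a ` {..<j}"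
    using assms(2) by (metis imageI image_subsetI lessThan_iff mod_less_divisor)
  then show ?thesis by (meson bounded_subset finite_imageI finite_imp_bounded finite_lessThan)
qed

definition diag_per :: "supernatural \<Rightarrow> bop set" where
  "diag_per N = {diag a | a j. divides_supernatural j N \<and> periodic j a}"

definition star_subalgebra :: "bop set \<Rightarrow> bool" where
  "star_subalgebra B \<longleftrightarrow>
     0 \<in> B \<and>
     (\<forall>S\<in>B. \<forall>T\<in>B. S + T \<in> B \<and> S * T \<in> B) \<and>
     (\<forall>c. \<forall>S\<in>B. c *\<^sub>C S \<in> B) \<and>
     (\<forall>S\<in>B. adj S \<in> B)"

definition star_algebra_generated :: "bop set \<Rightarrow> bop set" where
  "star_algebra_generated X = \<Inter>{B. star_subalgebra B \<and> X \<subseteq> B}"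

definition cstar_algebra_generated :: "bop set \<Rightarrow> bop set" where
  "cstar_algebra_generated X = \<Inter>{B. star_subalgebra B \<and> closed B \<and> X \<subseteq> B}"

definition poly_alg :: "supernatural \<Rightarrow> bop set" where
  "poly_alg N = star_algebra_generated (insert U (insert (adj U) (diag_per N)))"

definition cstar_alg :: "supernatural \<Rightarrow> bop set" where
  "cstar_alg N = cstar_algebra_generated (insert U (diag_per N))"


section \<open>Derivations\<close>

text \<open>
  A derivation is a map on \<^term>\<open>poly_alg N\<close>, represented by a function on all operators whose
  values outside \<^term>\<open>poly_alg N\<close> are irrelevant. No continuity is assumed.
\<close>

definition derivation :: "supernatural \<Rightarrow> (bop \<Rightarrow> bop) \<Rightarrow> bool" where
  "derivation N d \<longleftrightarrow>
     (\<forall>a\<in>poly_alg N. d a \<in> cstar_alg N) \<and>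
     (\<forall>a\<in>poly_alg N. \<forall>b\<in>poly_alg N. d (a + b) = d a + d b) \<and>
     (\<forall>c. \<forall>a\<in>poly_alg N. d (c *\<^sub>C a) = c *\<^sub>C d a) \<and>
     (\<forall>a\<in>poly_alg N. \<forall>b\<in>poly_alg N. d (a * b) = d a * b + a * d b)"

definition inner_derivation :: "supernatural \<Rightarrow> (bop \<Rightarrow> bop) \<Rightarrow> bool" where
  "inner_derivation N d \<longleftrightarrow>
     derivation N d \<and> (\<exists>z\<in>cstar_alg N. \<forall>a\<in>poly_alg N. d a = z * a - a * z)"

definition exp_i_K :: "real \<Rightarrow> bop" where
  "exp_i_K \<theta> = diag (\<lambda>k. exp (\<i> * complex_of_real \<theta> * of_nat k))"

definition rho :: "real \<Rightarrow> bop \<Rightarrow> bop" where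
  "rho \<theta> a = exp_i_K \<theta> * a * exp_i_K (- \<theta>)"

text \<open>
  Every \<^term>\<open>rho \<theta>\<close> acts on all bounded operators, where it is bijective; hence \<open>inv (rho \<theta>)\<close> is an
  honest inverse and restricts to the inverse of the automorphism of \<^term>\<open>cstar_alg N\<close>.
\<close>

lemma bop_eqI_E:
  assumes "\<And>k. bop_apply S (E k) = bop_apply T (E k)"
  shows "S = T"
proof (rule bop_eqI, rule LIMSEQ_unique)
  fix x
  have lim: "(\<lambda>n. bop_apply V (\<Sum>k<n. ell2_nth x k *\<^sub>C E k)) \<longlonglongrightarrow> bop_apply V x" for V
    by (intro bounded_linear.tendsto[OF bounded_linear_bop] ell2_partial_sums)
  have eq: "bop_apply S (\<Sum>k<n. ell2_nth x k *\<^sub>C E k) = bop_apply T (\<Sum>k<n. ell2_nth x k *\<^sub>C E k)"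
    for n
    by (simp add: linear_sum[OF bounded_linear.linear[OF bounded_linear_bop]]
        bop_apply_scaleC assms)
  show "(\<lambda>n. bop_apply S (\<Sum>k<n. ell2_nth x k *\<^sub>C E k)) \<longlonglongrightarrow> bop_apply S x" by (rule lim)
  show "(\<lambda>n. bop_apply S (\<Sum>k<n. ell2_nth x k *\<^sub>C E k)) \<longlonglongrightarrow> bop_apply T x"
    unfolding eq by (rule lim)
qed

lemma exp_i_K_E: "bop_apply (exp_i_K \<theta>) (E k) = exp (\<i> * complex_of_real \<theta> * of_nat k) *\<^sub>C E k"
  unfolding exp_i_K_def
  by (rule diag_E) (auto simp: bounded_iff norm_exp_eq_Re intro!: exI[of _ 1])

lemma exp_i_K_inverse: "exp_i_K \<theta> * exp_i_K (- \<theta>) = 1"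
  by (rule bop_eqI_E) (simp add: exp_i_K_E bop_apply_scaleC scaleC_scaleC scaleC_one flip: exp_add)

lemma rho_rho_minus: "rho \<theta> (rho (- \<theta>) a) = a"
proof -
  have "rho \<theta> (rho (- \<theta>) a) =
      (exp_i_K \<theta> * exp_i_K (- \<theta>)) * a * (exp_i_K \<theta> * exp_i_K (- \<theta>))"
    unfolding rho_def by (simp add: mult.assoc)
  then show ?thesis by (simp add: exp_i_K_inverse)
qed

lemma inv_rho: "inv (rho \<theta>) = rho (- \<theta>)"
  using rho_rho_minus[of \<theta>] rho_rho_minus[of "- \<theta>"] by (intro inv_equality) simp_all

definition covariant :: "supernatural \<Rightarrow> int \<Rightarrow> (bop \<Rightarrow> bop) \<Rightarrow> bool" where
  "covariant N n d \<longleftrightarrow>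
     (\<forall>\<theta>. 0 \<le> \<theta> \<and> \<theta> < 2 * pi \<longrightarrow>
       (\<forall>a\<in>poly_alg N.
         inv (rho \<theta>) (d (rho \<theta> a)) = exp (- \<i> * of_int n * complex_of_real \<theta>) *\<^sub>C d a))"

end

theory Submission
  imports Defs
begin

text \<open>
  Some \<open>j\<close> dividing \<open>N\<close> does not divide \<open>n\<close>. For \<open>\<theta> = 2\<pi>/j\<close> the unitary \<open>u = e\<^sup>i\<^sup>\<theta>\<^sup>\<K>\<close> has
  \<open>j\<close>-periodic diagonal, so it lies in the algebra and \<open>\<rho>\<^sub>\<theta>\<close> is conjugation by \<open>u\<close>. Apply \<open>d\<close> to
  \<open>u x = \<rho>\<^sub>\<theta>(x) u\<close>: covariance gives \<open>d(\<rho>\<^sub>\<theta>(x)) = w u d(x) u\<^sup>-\<^sup>1\<close> with \<open>w = e\<^sup>-\<^sup>i\<^sup>n\<^sup>\<theta>\<close>, and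
  multiplying by \<open>u\<^sup>-\<^sup>1\<close> from the left leaves \<open>[u\<^sup>-\<^sup>1 d(u), x] = (w - 1) d(x)\<close>. As \<open>w \<noteq> 1\<close>, the
  derivation is inner.
\<close>

text \<open>A finite \<open>N\<close> is itself a divisor of the required kind. For infinite
  \<open>N\<close> a prime power exceeding \<open>|n|\<close> serves, because a nonzero integer has
  no divisor larger than its absolute value.\<close>

lemma exists_divisor_not_dvd:
  fixes n :: int
  assumes "(\<not> finite_supernatural N \<and> n \<noteq> 0) \<or>
    (finite_supernatural N \<and> \<not> int (nat_of_supernatural N) dvd n)"
  obtains j where "divides_supernatural j N" "\<not> int j dvd n"
proof (cases "finite_supernatural N")
  case True
  have "0 < nat_of_supernatural N"
    unfolding nat_of_supernatural_def by (auto intro!: prod_pos simp: prime_gt_0_nat)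
  then have "divides_supernatural (nat_of_supernatural N) N"
    by (simp add: divides_supernatural_def multiplicity_nat_of_supernatural[OF True])
  with True assms show thesis using that by blast
next
  case False
  with assms have n: "n \<noteq> 0" by blast
  have "\<exists>p e. prime p \<and> enat e \<le> N p \<and> nat \<bar>n\<bar> < p ^ e"
  proof (cases "\<exists>p. prime p \<and> N p = \<infinity>")
    case True
    then obtain p where p: "prime p" "N p = \<infinity>" by blast
    \<comment> \<open>An infinite exponent admits every power of \<open>p\<close>; as
      \<open>p \<ge> 2\<close>, the exponent \<open>|n|\<close> is already large enough.\<close>
    then have "nat \<bar>n\<bar> < p ^ nat \<bar>n\<bar>"
      by (intro power_gt_expt) (simp add: prime_gt_Suc_0_nat)
    with p show ?thesis by (metis enat_ord_code(3))
  next
    case False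
    \<comment> \<open>With all exponents at primes finite, an infinite \<open>N\<close> involves
      infinitely many primes, so one beyond \<open>|n|\<close> occurs and its first power
      suffices.\<close>
    with \<open>\<not> finite_supernatural N\<close> have "infinite {p. prime p \<and> N p \<noteq> 0}"
      by (auto simp: finite_supernatural_iff)
    then obtain p where "nat \<bar>n\<bar> < p" "prime p" "N p \<noteq> 0"
      unfolding infinite_nat_iff_unbounded by blast
    then have "prime p \<and> enat 1 \<le> N p \<and> nat \<bar>n\<bar> < p ^ 1"
      by (cases "N p") (auto simp: zero_enat_def)
    then show ?thesis by blast
  qed
  then obtain p e where p: "prime p" "enat e \<le> N p" "nat \<bar>n\<bar> < p ^ e" by blast
  have "multiplicity q (p ^ e) = (if q = p then e else 0)" if "prime q" for q
    using p(1) that by (auto simp: multiplicity_distinct_prime_power prime_gt_1_nat)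
  then have "divides_supernatural (p ^ e) N"
    using p by (simp add: divides_supernatural_def prime_gt_0_nat flip: zero_enat_def)
  moreover have "\<not> int (p ^ e) dvd n"
  proof
    assume "int (p ^ e) dvd n"
    then have "\<bar>int (p ^ e)\<bar> \<le> \<bar>n\<bar>" by (rule dvd_imp_le_int[OF n])
    with p(3) show False by linarith
  qed
  ultimately show thesis by (rule that)
qed

lemma periodic_exp:
  assumes "exp (\<i> * complex_of_real \<theta> * of_nat j) = 1"
  shows "periodic j (\<lambda>k. exp (\<i> * complex_of_real \<theta> * of_nat k))"
  using assms by (simp add: periodic_def distrib_left exp_add)

text \<open>At such angles the unitary implementing \<open>rho \<theta>\<close> belongs to the
  algebra, so \<open>d\<close> can be applied to it.\<close>

lemma exp_i_K_in_diag_per: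
  assumes "divides_supernatural j N" "exp (\<i> * complex_of_real \<theta> * of_nat j) = 1"
  shows "exp_i_K \<theta> \<in> diag_per N"
  using assms periodic_exp unfolding exp_i_K_def diag_per_def by blast

lemma diag_per_subset_poly_alg: "diag_per N \<subseteq> poly_alg N"
  unfolding poly_alg_def star_algebra_generated_def by blast

lemma poly_alg_mult: "S \<in> poly_alg N \<Longrightarrow> T \<in> poly_alg N \<Longrightarrow> S * T \<in> poly_alg N"
  unfolding poly_alg_def star_algebra_generated_def star_subalgebra_def by blast

lemma diag_per_subset_cstar_alg: "diag_per N \<subseteq> cstar_alg N"
  unfolding cstar_alg_def cstar_algebra_generated_def by blast

lemma cstar_alg_mult: "S \<in> cstar_alg N \<Longrightarrow> T \<in> cstar_alg N \<Longrightarrow> S * T \<in> cstar_alg N"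
  unfolding cstar_alg_def cstar_algebra_generated_def star_subalgebra_def by blast

lemma cstar_alg_scaleC: "S \<in> cstar_alg N \<Longrightarrow> c *\<^sub>C S \<in> cstar_alg N"
  unfolding cstar_alg_def cstar_algebra_generated_def star_subalgebra_def by blast

lemma bop_scaleC_mult:
  fixes S T :: bop
  shows "(c *\<^sub>C S) * T = c *\<^sub>C (S * T)" "S * (c *\<^sub>C T) = c *\<^sub>C (S * T)"
  by (rule bop_eqI; simp add: bop_apply_scaleC)+

lemma bop_scaleC_diff_left: "(b - c) *\<^sub>C S = b *\<^sub>C S - c *\<^sub>C (S :: bop)"
  by (metis add_diff_cancel diff_add_cancel scaleC_add_left)

lemma bop_scaleC_diff_right: "c *\<^sub>C (S - T) = c *\<^sub>C S - c *\<^sub>C (T :: bop)"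
  by (metis add_diff_cancel diff_add_cancel scaleC_add_right)

lemma exp_i_K_inverse': "exp_i_K (- \<theta>) * exp_i_K \<theta> = 1"
  using exp_i_K_inverse[of "- \<theta>"] by simp

lemma covariant_derivation_commutator:
  assumes d: "derivation N d" and cov: "covariant N n d"
    and \<theta>: "0 \<le> \<theta>" "\<theta> < 2 * pi"
    and u: "exp_i_K \<theta> \<in> poly_alg N" "exp_i_K (- \<theta>) \<in> poly_alg N"
    and x: "x \<in> poly_alg N"
  shows "exp_i_K (- \<theta>) * d (exp_i_K \<theta>) * x - x * (exp_i_K (- \<theta>) * d (exp_i_K \<theta>)) =
    (exp (- \<i> * of_int n * complex_of_real \<theta>) - 1) *\<^sub>C d x"
proof -
  define u v w where "u = exp_i_K \<theta>" and "v = exp_i_K (- \<theta>)"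
    and "w = exp (- \<i> * of_int n * complex_of_real \<theta>)"
  have vu: "v * u = 1" "v * (u * y) = y" for y
    by (simp_all add: u_def v_def exp_i_K_inverse' flip: mult.assoc)
  \<comment> \<open>The Leibniz rule is available only on \<open>poly_alg N\<close>, so the product
    \<open>rho \<theta> x = u * x * v\<close> has to be placed there first.\<close>
  have in_alg: "u \<in> poly_alg N" "rho \<theta> x \<in> poly_alg N"
    using u x by (simp_all add: u_def rho_def poly_alg_mult)
  have leibniz: "d (a * b) = d a * b + a * d b" if "a \<in> poly_alg N" "b \<in> poly_alg N" for a b
    using d that by (simp add: derivation_def)
  have "rho (- \<theta>) (d (rho \<theta> x)) = w *\<^sub>C d x"
    using cov \<theta> x by (simp add: covariant_def inv_rho w_def)
  then have "d (rho \<theta> x) = rho \<theta> (w *\<^sub>C d x)"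
    by (metis rho_rho_minus)
  then have d_rho: "d (rho \<theta> x) = w *\<^sub>C (u * d x * v)"
    by (simp add: rho_def u_def v_def bop_scaleC_mult)
  have "u * x = rho \<theta> x * u"
    by (simp add: rho_def mult.assoc exp_i_K_inverse' u_def)
  then have "d u * x + u * d x = d (rho \<theta> x) * u + rho \<theta> x * d u"
    using leibniz in_alg x by metis
  \<comment> \<open>The first summand shrinks by \<open>v * u = 1\<close>; in the second, unfolding
    \<open>rho \<theta> x\<close> exposes the factor \<open>v * d u\<close> of the
    commutator.\<close>
  also have "\<dots> = w *\<^sub>C (u * d x) + u * x * (v * d u)"
    by (simp add: d_rho bop_scaleC_mult mult.assoc vu) (simp add: rho_def u_def v_def mult.assoc)
  finally have "v * (d u * x + u * d x) = v * (w *\<^sub>C (u * d x) + u * x * (v * d u))"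
    by simp
  then have "v * d u * x + d x = w *\<^sub>C d x + x * (v * d u)"
    by (simp add: distrib_left bop_scaleC_mult mult.assoc vu)
  then have "v * d u * x - x * (v * d u) = (w - 1) *\<^sub>C d x"
    by (simp add: bop_scaleC_diff_left scaleC_one algebra_simps)
  then show ?thesis
    unfolding u_def v_def w_def .
qed

text \<open>The value 1 would make \<open>2 * pi * n / j\<close> an integral multiple of
  \<open>2 * pi\<close>, hence \<open>n\<close> a multiple of \<open>j\<close>.\<close>

lemma exp_2pi_fraction_neq_1:
  assumes "0 < j" "\<not> int j dvd n"
  shows "exp (- \<i> * of_int n * complex_of_real (2 * pi / real j)) \<noteq> 1"
proof
  assume "exp (- \<i> * of_int n * complex_of_real (2 * pi / real j)) = 1"
  then obtain m :: int where "- (of_int n * (2 * pi / real j)) = of_int (2 * m) * pi"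
    by (auto simp: exp_eq_1)
  then have "pi * real_of_int n = pi * real_of_int (- m * int j)"
    using assms(1) by (simp add: field_simps)
  then have "real_of_int n = real_of_int (- m * int j)"
    using pi_neq_zero mult_left_cancel by blast
  then have "n = - m * int j" by (simp only: of_int_eq_iff)
  then show False using assms(2) by simp
qed

theorem theorem3p11:
  fixes N :: supernatural and n :: int and d :: "bop \<Rightarrow> bop"
  assumes "derivation N d"
    and "covariant N n d"
    and "(\<not> finite_supernatural N \<and> n \<noteq> 0) \<or>
         (finite_supernatural N \<and> \<not> int (nat_of_supernatural N) dvd n)"
  shows "inner_derivation N d"
proof -
  obtain j where j: "divides_supernatural j N" "\<not> int j dvd n"
    using exists_divisor_not_dvd[OF assms(3)] .
  have "0 < j" using j(1) by (simp add: divides_supernatural_def)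
  \<comment> \<open>Since 1 divides \<open>n\<close>, \<open>j\<close> is at least 2. This keeps
    \<open>\<theta> = 2 * pi / j\<close> strictly below \<open>2 * pi\<close>, inside the range
    where covariance is given.\<close>
  moreover have "j \<noteq> 1" using j(2) by auto
  ultimately have "2 \<le> j" by simp
  define \<theta> where "\<theta> = 2 * pi / real j"
  have \<theta>: "0 \<le> \<theta>" "\<theta> < 2 * pi"
    using \<open>2 \<le> j\<close> by (simp_all add: \<theta>_def field_simps)
  have "exp (\<i> * complex_of_real \<theta> * of_nat j) = 1" "exp (\<i> * complex_of_real (- \<theta>) * of_nat j) = 1"
    using \<open>0 < j\<close> exp_two_pi_i' by (simp_all add: \<theta>_def exp_minus mult.commute)
  then have diag_per: "exp_i_K \<theta> \<in> diag_per N" "exp_i_K (- \<theta>) \<in> diag_per N"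
    using exp_i_K_in_diag_per j(1) by blast+
  then have u: "exp_i_K \<theta> \<in> poly_alg N" "exp_i_K (- \<theta>) \<in> poly_alg N"
    using diag_per_subset_poly_alg by blast+
  define c where "c = exp (- \<i> * of_int n * complex_of_real \<theta>) - 1"
  have "c \<noteq> 0"
    using exp_2pi_fraction_neq_1[OF \<open>0 < j\<close> j(2)] by (simp add: c_def \<theta>_def)
  \<comment> \<open>As \<open>[y, x] = c d(x)\<close> with \<open>c \<noteq> 0\<close>, the
    implementing element is \<open>y\<close> divided by \<open>c\<close>; it lies in
    \<open>cstar_alg N\<close> because \<open>d\<close> takes its values there.\<close>
  define y where "y = exp_i_K (- \<theta>) * d (exp_i_K \<theta>)"
  have "d (exp_i_K \<theta>) \<in> cstar_alg N"
    using assms(1) u(1) by (simp add: derivation_def)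
  then have "inverse c *\<^sub>C y \<in> cstar_alg N"
    unfolding y_def using diag_per(2) diag_per_subset_cstar_alg
    by (blast intro: cstar_alg_scaleC cstar_alg_mult)
  moreover have "d x = (inverse c *\<^sub>C y) * x - x * (inverse c *\<^sub>C y)" if "x \<in> poly_alg N" for x
  proof -
    have "y * x - x * y = c *\<^sub>C d x"
      unfolding y_def c_def
      using covariant_derivation_commutator[OF assms(1,2) \<theta> u that] .
    then have "inverse c *\<^sub>C (y * x - x * y) = d x"
      using \<open>c \<noteq> 0\<close> by (simp add: scaleC_scaleC scaleC_one)
    then show ?thesis
      by (simp add: bop_scaleC_mult bop_scaleC_diff_right)
  qed
  ultimately show ?thesis
    using assms(1) unfolding inner_derivation_def by blast
qed

end
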